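(* Let $2\le r_1<r_2$ be integers, let $T=[h,q_1,q_2]\in\mathfrak{F}(n)$ with $q_1\ge3$, and let $T'=[h,q_1-1,q_2+1]$. Then $\rho(T)>\rho(T')$.
   Context: $\rho(G)$ denotes the spectral radius (largest eigenvalue of the adjacency matrix) of a graph $G$. For integers $h,q_1,q_2\ge 2$ and fixed integers $2\le r_1<r_2$, the tree $[h,q_1,q_2]$ is constructed as follows: take a vertex $u$; attach to $u$ a pendant path with $h$ edges; attach to $u$ a path with $q_1$ edges ending at a vertex $v_1$, and attach to $v_1$ exactly $r_1$ pendant paths with $2$ edges each; attach to $u$ a path with $q_2$ edges ending at a vertex $v_2$, and attach to $v_2$ exactly $r_2$ pendant paths with $2$ edges each. It has $n=1+h+q_1+q_2+2(r_1+r_2)$ vertices. $\mathfrak{F}(n)$ is the set of all such trees $[h,q_1,q_2]$ with $h,q_1,q_2\ge2$ and $h+q_1+q_2=n-1-2(r_1+r_2)$. The tree $T'$ is obtained from $T$ by a 2-switch (removing two edges $ab,cd$ with $ac,bd$ non-edges and adding $ac,bd$), so it has the same degree sequence. *)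

theory Defs
  imports "Jordan_Normal_Form.Spectral_Radius"
begin

definition path_edges :: "nat \<Rightarrow> nat \<Rightarrow> nat \<Rightarrow> (nat \<times> nat) set" where
  "path_edges a start len =
     (if len = 0 then {} else
      {(a, start)} \<union> {(start + k, start + k + 1) | k. k + 1 < len})"

definition tree_order :: "nat \<Rightarrow> nat \<Rightarrow> nat \<Rightarrow> nat \<Rightarrow> nat \<Rightarrow> nat" where
  "tree_order r1 r2 h q1 q2 = 1 + h + q1 + q2 + 2 * (r1 + r2)"

(* Edge set of the tree [h,q1,q2] on vertices {0..<tree_order r1 r2 h q1 q2}:
   u = 0; pendant path on 1..h; path of q1 edges on h+1..h+q1 ending at v1 = h+q1;
   path of q2 edges on h+q1+1..h+q1+q2 ending at v2 = h+q1+q2;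
   r1 pendant 2-edge paths at v1, r2 pendant 2-edge paths at v2. *)
definition tree_edges :: "nat \<Rightarrow> nat \<Rightarrow> nat \<Rightarrow> nat \<Rightarrow> nat \<Rightarrow> (nat \<times> nat) set" where
  "tree_edges r1 r2 h q1 q2 =
     (let v1 = h + q1; v2 = h + q1 + q2;
          b1 = h + q1 + q2 + 1; b2 = b1 + 2 * r1
      in path_edges 0 1 h \<union> path_edges 0 (h + 1) q1 \<union> path_edges 0 (h + q1 + 1) q2
         \<union> (\<Union>i<r1. path_edges v1 (b1 + 2 * i) 2)
         \<union> (\<Union>i<r2. path_edges v2 (b2 + 2 * i) 2))"

definition tree_adj :: "nat \<Rightarrow> nat \<Rightarrow> nat \<Rightarrow> nat \<Rightarrow> nat \<Rightarrow> complex mat" where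
  "tree_adj r1 r2 h q1 q2 =
     mat (tree_order r1 r2 h q1 q2) (tree_order r1 r2 h q1 q2)
       (\<lambda>(i, j). if (i, j) \<in> tree_edges r1 r2 h q1 q2 \<or> (j, i) \<in> tree_edges r1 r2 h q1 q2
                 then 1 else 0)"

definition tree_rho :: "nat \<Rightarrow> nat \<Rightarrow> nat \<Rightarrow> nat \<Rightarrow> nat \<Rightarrow> real" where
  "tree_rho r1 r2 h q1 q2 = spectral_radius (tree_adj r1 r2 h q1 q2)"

end

theory Submission
  imports Defs
begin

text \<open>
  With \<open>T = t\<^sup>2 > 1\<close>, \<open>\<lambda> = t + 1/t\<close> and \<open>k\<^sub>i = r\<^sub>i - 1\<close> the eigenvalue equations at all vertices
  except \<open>u\<close> are solved explicitly: on each of the three paths at \<open>u\<close> the eigenvector is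
  proportional to \<open>c t\<^sup>m + t\<^sup>-\<^sup>m\<close>, where \<open>m\<close> is the distance from the far end and the
  coefficient \<open>c\<^sub>i\<close> belonging to the hub \<open>v\<^sub>i\<close> is a rational function of \<open>T\<close> and \<open>k\<^sub>i\<close>. The remaining equation at \<open>u\<close> is a scalar secular equation
  in \<open>T\<close>. A root at which both hub coefficients are positive gives a positive eigenvector, so
  \<open>\<lambda>\<close> is then the spectral radius, by comparing an arbitrary eigenvector with the positive one.

  The secular function is negative where the heavier hub coefficient vanishes and positive for
  large \<open>T\<close>, which yields such a root \<open>T\<^sub>0\<close> for the tree \<open>[h, q\<^sub>1 - 1, q\<^sub>2 + 1]\<close>. Put \<open>X\<^sub>1 = c\<^sub>1 T\<^sub>0\<close>\<open>^(q\<^sub>1 - 1)\<close> and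
  \<open>X\<^sub>2 = c\<^sub>2 T\<^sub>0\<close>\<open>^q\<^sub>2\<close>. Passing back to \<open>[h, q\<^sub>1, q\<^sub>2]\<close> changes the secular function
  at \<open>T\<^sub>0\<close> by an amount of sign opposite to \<open>(X\<^sub>1 - X\<^sub>2)(T\<^sub>0 X\<^sub>1 X\<^sub>2 - 1)\<close>, and both factors are
  positive because \<open>T\<^sub>0\<close> is a root. Hence \<open>[h, q\<^sub>1, q\<^sub>2]\<close> has a root beyond \<open>T\<^sub>0\<close>.
\<close>

subsection \<open>Eigenvectors of the tree\<close>

text \<open>The tree is rooted at \<open>u = 0\<close>. The numbering gives every child a larger
  number than its parent, so the edge set is the graph of this function on the nonzero vertices.
  Legs occupy consecutive pairs of numbers, so parity separates inner vertices from leaves.\<close>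

definition parent :: "nat \<Rightarrow> nat \<Rightarrow> nat \<Rightarrow> nat \<Rightarrow> nat \<Rightarrow> nat" where
  "parent r1 h q1 q2 j =
     (if j \<le> h + q1 + q2 then (if j \<in> {1, h + 1, h + q1 + 1} then 0 else j - 1)
      else if even (j - (h + q1 + q2 + 1))
           then (if j < h + q1 + q2 + 1 + 2 * r1 then h + q1 else h + q1 + q2)
           else j - 1)"

lemma path_edges_2: "path_edges a b 2 = {(a, b), (b, b + 1)}"
  by (auto simp: path_edges_def)

lemma path_edges_pos:
  assumes "1 \<le> l"
  shows "(i, j) \<in> path_edges a b l \<longleftrightarrow> i = a \<and> j = b \<or> b < j \<and> j < b + l \<and> i = j - 1"
proof -
  have "\<exists>k. i = b + k \<and> j = Suc (b + k) \<and> Suc k < l" if "b < j" "j < b + l" "i = j - 1"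
    using that by (intro exI[of _ "j - 1 - b"]) auto
  with assms show ?thesis by (auto simp: path_edges_def)
qed

lemma legs_edges:
  "(i, j) \<in> (\<Union>k<r. path_edges v (b + 2 * k) 2) \<longleftrightarrow>
     b \<le> j \<and> j < b + 2 * r \<and> i = (if even (j - b) then v else j - 1)"
proof -
  have "(i, j) \<in> (\<Union>k<r. path_edges v (b + 2 * k) 2) \<longleftrightarrow>
      (\<exists>k<r. i = v \<and> j = b + 2 * k \<or> i = b + 2 * k \<and> j = b + 2 * k + 1)"
    by (auto simp: path_edges_2)
  also have "\<dots> \<longleftrightarrow> b \<le> j \<and> j < b + 2 * r \<and> i = (if even (j - b) then v else j - 1)"
    (is "?L \<longleftrightarrow> ?R")
  proof
    assume ?R
    then obtain d where "j = b + d" using le_Suc_ex by blast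
    with \<open>?R\<close> show ?L by (intro exI[of _ "d div 2"]) (auto elim!: evenE oddE)
  qed auto
  finally show ?thesis .
qed

lemma tree_edges_iff:
  assumes "1 \<le> h" "1 \<le> q1" "1 \<le> q2"
  shows "(i, j) \<in> tree_edges r1 r2 h q1 q2 \<longleftrightarrow>
     1 \<le> j \<and> j < tree_order r1 r2 h q1 q2 \<and> i = parent r1 h q1 q2 j"
proof -
  define b where "b = h + q1 + q2 + 1"
  have b: "h + q1 + q2 < b" "b \<le> h + q1 + q2 + 1" by (simp_all add: b_def)
  have par: "parent r1 h q1 q2 j =
     (if j < b then (if j = 1 \<or> j = h + 1 \<or> j = h + q1 + 1 then 0 else j - 1)
      else if even (j - b) then (if j < b + 2 * r1 then h + q1 else h + q1 + q2) else j - 1)"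
    by (auto simp: b_def parent_def)
  have order: "tree_order r1 r2 h q1 q2 = b + 2 * r1 + 2 * r2"
    by (simp add: b_def tree_order_def)
  have "(i, j) \<in> tree_edges r1 r2 h q1 q2 \<longleftrightarrow>
     (i, j) \<in> path_edges 0 1 h \<or> (i, j) \<in> path_edges 0 (h + 1) q1 \<or>
     (i, j) \<in> path_edges 0 (h + q1 + 1) q2 \<or>
     (i, j) \<in> (\<Union>k<r1. path_edges (h + q1) (b + 2 * k) 2) \<or>
     (i, j) \<in> (\<Union>k<r2. path_edges (h + q1 + q2) (b + 2 * r1 + 2 * k) 2)"
    unfolding tree_edges_def Let_def b_def by blast
  also have "\<dots> \<longleftrightarrow> 1 \<le> j \<and> j < tree_order r1 r2 h q1 q2 \<and> i = parent r1 h q1 q2 j"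
    unfolding path_edges_pos[OF assms(1)] path_edges_pos[OF assms(2)] path_edges_pos[OF assms(3)]
      legs_edges order par
    using assms b
    apply (cases "j < b")
     apply (auto split: if_splits)[1]
    apply (cases "j < b + 2 * r1")
     apply (auto split: if_splits)[1]
    \<comment> \<open>The second block of legs starts at the even offset \<open>2 * r1\<close>, so
      one parity test serves both blocks.\<close>
    apply (subgoal_tac "even (j - (b + 2 * r1)) \<longleftrightarrow> even (j - b)")
     apply (auto split: if_splits)[2]
    done
  finally show ?thesis .
qed

lemma parent_less:
  assumes "1 \<le> h" "1 \<le> q1" "1 \<le> q2" "1 \<le> j"
  shows "parent r1 h q1 q2 j < j"
  using assms by (auto simp: parent_def)

text \<open>The neighbours of a vertex are its parent and its children; the two sets are disjoint
  because parents carry smaller numbers.\<close>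

lemma tree_row_sum:
  fixes x :: "nat \<Rightarrow> real"
  assumes pos: "1 \<le> h" "1 \<le> q1" "1 \<le> q2" and i: "i < tree_order r1 r2 h q1 q2"
  shows "(\<Sum>j<tree_order r1 r2 h q1 q2.
            (if (i, j) \<in> tree_edges r1 r2 h q1 q2 \<or> (j, i) \<in> tree_edges r1 r2 h q1 q2
             then 1 else 0) * x j) =
         (if i = 0 then 0 else x (parent r1 h q1 q2 i)) +
         sum x {j. 1 \<le> j \<and> j < tree_order r1 r2 h q1 q2 \<and> i = parent r1 h q1 q2 j}"
    (is "?L = ?P + sum x ?C")
proof -
  let ?n = "tree_order r1 r2 h q1 q2" and ?p = "parent r1 h q1 q2"
  let ?U = "if i = 0 then {} else {?p i}"
  have fin: "finite ?C" by simp
  have disj: "?U \<inter> ?C = {}"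
    using parent_less[OF pos, of i r1] parent_less[OF pos, of "?p i" r1] by auto
  have "?L = sum x {j. j < ?n \<and> ((i, j) \<in> tree_edges r1 r2 h q1 q2 \<or>
                                  (j, i) \<in> tree_edges r1 r2 h q1 q2)}"
    by (rule sum.mono_neutral_cong_right) auto
  also have "{j. j < ?n \<and> ((i, j) \<in> tree_edges r1 r2 h q1 q2 \<or>
               (j, i) \<in> tree_edges r1 r2 h q1 q2)} = ?U \<union> ?C"
    using parent_less[OF pos, of i r1] i unfolding tree_edges_iff[OF pos] by auto
  also have "sum x (?U \<union> ?C) = sum x ?U + sum x ?C"
    using fin disj by (intro sum.union_disjoint) auto
  finally show ?thesis by simp
qed

text \<open>The legs of both hubs are counted together: \<open>b + 2 * k\<close> is the inner vertex
  of leg \<open>k\<close>, and the first \<open>r1\<close> legs hang at \<open>v1\<close>.\<close>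

lemma children:
  assumes "1 \<le> h" "1 \<le> q1" "1 \<le> q2" and "i < tree_order r1 r2 h q1 q2"
  defines "b \<equiv> h + q1 + q2 + 1"
  shows "{j. 1 \<le> j \<and> j < tree_order r1 r2 h q1 q2 \<and> i = parent r1 h q1 q2 j} =
    (if i = 0 then {1, h + 1, h + q1 + 1}
     else if i = h then {}
     else if i = h + q1 then (\<lambda>k. b + 2 * k) ` {..<r1}
     else if i = h + q1 + q2 then (\<lambda>k. b + 2 * k) ` {r1..<r1 + r2}
     else if i < b \<or> even (i - b) then {i + 1} else {})" (is "?C = ?R")
proof -
  have im: "j \<in> (\<lambda>k. b + 2 * k) ` {l..<m} \<longleftrightarrow> b + 2 * l \<le> j \<and> j < b + 2 * m \<and> even (j - b)"
    for j l m
  proof -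
    have "j \<in> (\<lambda>k. b + 2 * k) ` {l..<m}" if "b + 2 * l \<le> j" "j < b + 2 * m" "even (j - b)"
    proof -
      have "b \<le> j" using that(1) by simp
      then obtain d where d: "j = b + d" using le_Suc_ex by blast
      show ?thesis
        using that by (intro image_eqI[of _ _ "d div 2"]) (auto simp: d elim!: evenE)
    qed
    then show ?thesis by auto
  qed
  have b: "h + q1 + q2 < b" "b \<le> h + q1 + q2 + 1" by (simp_all add: b_def)
  have mem: "j \<in> ?C \<longleftrightarrow> 1 \<le> j \<and> j < b + 2 * (r1 + r2) \<and> i = parent r1 h q1 q2 j" for j
    by (auto simp: b_def tree_order_def)
  have par: "parent r1 h q1 q2 j =
     (if j < b then (if j = 1 \<or> j = h + 1 \<or> j = h + q1 + 1 then 0 else j - 1)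
      else if even (j - b) then (if j < b + 2 * r1 then h + q1 else h + q1 + q2) else j - 1)" for j
    by (auto simp: b_def parent_def)
  have i': "i < b + 2 * (r1 + r2)" using assms(4) by (simp add: b_def tree_order_def)
  have "j \<in> ?C \<longleftrightarrow> j \<in> ?R" for j
  proof -
    consider "i = 0" | "i = h" | "i = h + q1" | "i = h + q1 + q2"
      | "i \<noteq> 0" "i \<noteq> h" "i \<noteq> h + q1" "i < h + q1 + q2"
      | d where "i = b + d" using b le_Suc_ex[of b i] by (cases "b \<le> i") force+
    then show ?thesis
    proof cases
      case 1
      then show ?thesis unfolding mem unfolding par using b assms(1-3) by (auto split: if_splits)
    next
      case 2
      then show ?thesis unfolding mem unfolding par using b assms(1-3) by (auto split: if_splits)
    next
      case 3
      then have R: "?R = (\<lambda>k. b + 2 * k) ` {0..<r1}" using assms(1-3) by (simp add: atLeast0LessThan)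
      then show ?thesis unfolding mem R im unfolding par using 3 b assms(1-3) by (auto split: if_splits)
    next
      case 4
      then have R: "?R = (\<lambda>k. b + 2 * k) ` {r1..<r1 + r2}" using assms(1-3) by simp
      then show ?thesis unfolding mem R im unfolding par using 4 b assms(1-3)
        by (cases "j = b") (auto split: if_splits)
    next
      case 5
      then have R: "?R = {i + 1}" using b by simp
      show ?thesis unfolding mem R unfolding par using 5 b assms(1-3) by (auto split: if_splits)
    next
      case (6 d)
      then have R: "?R = (if even d then {i + 1} else {})" using assms(1-3) by (simp add: b_def)
      have "d + 1 < 2 * (r1 + r2)" if "even d"
        using that i' 6 by presburger
      note d = this
      show ?thesis
      proof (cases "j < b")
        case True
        then show ?thesis unfolding mem R unfolding par using 6 b by auto
      next
        case False
        then obtain e where e: "j = b + e" using le_Suc_ex by (metis linorder_not_less)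
        have "parent r1 h q1 q2 j = i \<longleftrightarrow> odd e \<and> e = d + 1"
          unfolding par e 6 using b by (cases e) auto
        then have P: "i = parent r1 h q1 q2 j \<longleftrightarrow> odd e \<and> e = d + 1" by (simp only: eq_commute)
        show ?thesis unfolding mem R P using e 6(1) d b(1) by (cases "e = d + 1") auto
      qed
    qed
  qed
  then show ?thesis by blast
qed

text \<open>\<open>P\<close>, \<open>Q1\<close> and \<open>Q2\<close> take the distance from
  \<open>u\<close> as argument. On a leg at a hub of value \<open>H\<close>, the inner value
  \<open>y\<close> and the leaf value \<open>z\<close> solve \<open>l * y = H + z\<close> and
  \<open>l * z = y\<close>.\<close>

definition tree_vec :: "nat \<Rightarrow> nat \<Rightarrow> nat \<Rightarrow> nat \<Rightarrow> real \<Rightarrow> (nat \<Rightarrow> real) \<Rightarrow> (nat \<Rightarrow> real)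
    \<Rightarrow> (nat \<Rightarrow> real) \<Rightarrow> nat \<Rightarrow> real" where
  "tree_vec r1 h q1 q2 l P Q1 Q2 i =
     (if i \<le> h then P i
      else if i \<le> h + q1 then Q1 (i - h)
      else if i \<le> h + q1 + q2 then Q2 (i - (h + q1))
      else (if i < h + q1 + q2 + 1 + 2 * r1 then Q1 q1 else Q2 q2) *
        (if even (i - (h + q1 + q2 + 1)) then l / (l^2 - 1) else 1 / (l^2 - 1)))"

text \<open>Along each arm only a three-term recurrence and an end condition are required. The
  assumption \<open>root\<close> is the equation at \<open>u\<close>, the one place where the three
  arms meet; the leg equations hold by construction of \<open>tree_vec\<close>.\<close>

lemma tree_vec_eigen:
  fixes l :: real
  assumes pos: "1 \<le> h" "1 \<le> q1" "1 \<le> q2" and i: "i < tree_order r1 r2 h q1 q2"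
    and l: "l^2 \<noteq> 1"
    and 0: "P 0 = 1" "Q1 0 = 1" "Q2 0 = 1"
    and root: "l = P 1 + Q1 1 + Q2 1"
    and P: "\<And>i. 1 \<le> i \<Longrightarrow> i < h \<Longrightarrow> l * P i = P (i - 1) + P (i + 1)" "l * P h = P (h - 1)"
    and Q1: "\<And>i. 1 \<le> i \<Longrightarrow> i < q1 \<Longrightarrow> l * Q1 i = Q1 (i - 1) + Q1 (i + 1)"
      "l * Q1 q1 = Q1 (q1 - 1) + r1 * (Q1 q1 * (l / (l^2 - 1)))"
    and Q2: "\<And>i. 1 \<le> i \<Longrightarrow> i < q2 \<Longrightarrow> l * Q2 i = Q2 (i - 1) + Q2 (i + 1)"
      "l * Q2 q2 = Q2 (q2 - 1) + r2 * (Q2 q2 * (l / (l^2 - 1)))"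
  defines "x \<equiv> tree_vec r1 h q1 q2 l P Q1 Q2"
  shows "(if i = 0 then 0 else x (parent r1 h q1 q2 i)) +
         sum x {j. 1 \<le> j \<and> j < tree_order r1 r2 h q1 q2 \<and> i = parent r1 h q1 q2 j} = l * x i"
proof -
  let ?p = "parent r1 h q1 q2"
  let ?S = "sum x {j. 1 \<le> j \<and> j < tree_order r1 r2 h q1 q2 \<and> i = ?p j}"
  define b where "b = h + q1 + q2 + 1"
  have b: "h + q1 + q2 < b" by (simp add: b_def)
  note ch = children[OF pos i, folded b_def]
  have par: "?p j =
     (if j < b then (if j = 1 \<or> j = h + 1 \<or> j = h + q1 + 1 then 0 else j - 1)
      else if even (j - b) then (if j < b + 2 * r1 then h + q1 else h + q1 + q2) else j - 1)" for j
    by (auto simp: b_def parent_def)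
  consider "i = 0" | "1 \<le> i" "i \<le> h" | d where "i = h + d" "1 \<le> d" "d \<le> q1"
    | d where "i = h + q1 + d" "1 \<le> d" "d \<le> q2" | d where "i = b + d"
  proof -
    consider "i = 0" | "1 \<le> i" "i \<le> h" | "h + 1 \<le> i" "i \<le> h + q1"
      | "h + q1 + 1 \<le> i" "i \<le> h + q1 + q2" | "b \<le> i"
      unfolding b_def by linarith
    then show ?thesis using that le_Suc_ex by cases fastforce+
  qed
  then show ?thesis
  proof cases
    case 1
    then have "?S = x 1 + x (h + 1) + x (h + q1 + 1)" unfolding ch using pos by simp
    also have "\<dots> = l * x i" using 1 pos root 0 by (simp add: x_def tree_vec_def)
    finally show ?thesis using 1 by simp
  next
    case 2
    have "?S = (if i = h then 0 else x (i + 1))" unfolding ch using 2 pos b by simp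
    moreover have "x (?p i) = P (i - 1)" using 2 pos b by (auto simp: par x_def tree_vec_def)
    ultimately show ?thesis using 2 P by (auto simp: x_def tree_vec_def)
  next
    case (3 d)
    have p: "x (?p i) = Q1 (d - 1)"
      using 3 pos b 0 by (auto simp: par x_def tree_vec_def le_diff_conv)
    show ?thesis
    proof (cases "d = q1")
      case True
      then have "?S = sum x ((\<lambda>k. b + 2 * k) ` {..<r1})" unfolding ch using 3 pos by simp
      also have "\<dots> = (\<Sum>k<r1. x (b + 2 * k))" by (subst sum.reindex) (auto simp: inj_on_def)
      also have "\<dots> = (\<Sum>k<r1. Q1 q1 * (l / (l^2 - 1)))"
        using b by (intro sum.cong) (auto simp: x_def tree_vec_def b_def)
      finally have "?S = r1 * (Q1 q1 * (l / (l^2 - 1)))" by simp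
      moreover have "x i = Q1 q1" using 3 True by (simp add: x_def tree_vec_def)
      moreover have "i \<noteq> 0" using 3 by simp
      ultimately show ?thesis using p Q1(2) True by simp
    next
      case False
      then have "?S = x (i + 1)" unfolding ch using 3 pos b by simp
      moreover have "x i = Q1 d" "x (i + 1) = Q1 (d + 1)"
        using 3 False by (simp_all add: x_def tree_vec_def)
      moreover have "l * Q1 d = Q1 (d - 1) + Q1 (d + 1)" using 3 False by (intro Q1(1)) auto
      moreover have "i \<noteq> 0" using 3 by simp
      ultimately show ?thesis using p by simp
    qed
  next
    case (4 d)
    have p: "x (?p i) = Q2 (d - 1)"
      using 4 pos b 0 by (auto simp: par x_def tree_vec_def le_diff_conv)
    show ?thesis
    proof (cases "d = q2")
      case True
      then have "?S = sum x ((\<lambda>k. b + 2 * k) ` {r1..<r1 + r2})" unfolding ch using 4 pos by simp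
      also have "\<dots> = (\<Sum>k=r1..<r1 + r2. x (b + 2 * k))" by (subst sum.reindex) (auto simp: inj_on_def)
      also have "\<dots> = (\<Sum>k=r1..<r1 + r2. Q2 q2 * (l / (l^2 - 1)))"
        using b by (intro sum.cong) (auto simp: x_def tree_vec_def b_def)
      finally have "?S = r2 * (Q2 q2 * (l / (l^2 - 1)))" by simp
      moreover have "x i = Q2 q2" using 4 pos True by (simp add: x_def tree_vec_def)
      moreover have "i \<noteq> 0" using 4 by simp
      ultimately show ?thesis using p Q2(2) True by simp
    next
      case False
      then have "?S = x (i + 1)" unfolding ch using 4 pos b by simp
      moreover have "x i = Q2 d" "x (i + 1) = Q2 (d + 1)"
        using 4 pos False by (simp_all add: x_def tree_vec_def)
      moreover have "l * Q2 d = Q2 (d - 1) + Q2 (d + 1)" using 4 False by (intro Q2(1)) auto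
      moreover have "i \<noteq> 0" using 4 by simp
      ultimately show ?thesis using p by simp
    qed
  next
    case (5 d)
    let ?hub = "if i < b + 2 * r1 then Q1 q1 else Q2 q2"
    have xb: "x j = (if j < b + 2 * r1 then Q1 q1 else Q2 q2) *
        (if even (j - b) then l / (l^2 - 1) else 1 / (l^2 - 1))" if "b \<le> j" for j
      using that unfolding x_def tree_vec_def b_def by simp
    have S: "?S = (if even d then x (i + 1) else 0)" unfolding ch using 5 pos b by simp
    show ?thesis
    proof (cases "even d")
      case True
      have "x (?p i) = ?hub" using 5 True pos by (simp add: par x_def tree_vec_def)
      moreover have "i + 1 < b + 2 * r1 \<longleftrightarrow> i < b + 2 * r1" using 5 True by (auto elim!: evenE)
      then have "x (i + 1) = ?hub * (1 / (l^2 - 1))" using 5 True xb[of "i + 1"] by simp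
      moreover have "x i = ?hub * (l / (l^2 - 1))" using 5 True xb[of i] by simp
      moreover have "H + H * (1 / (l^2 - 1)) = l * (H * (l / (l^2 - 1)))" for H
        using l by (simp add: field_simps power2_eq_square)
      ultimately show ?thesis using S True b 5 by simp
    next
      case False
      have "?p i = b + (d - 1)" using 5 False by (cases d) (auto simp: par)
      moreover have "b + (d - 1) < b + 2 * r1 \<longleftrightarrow> i < b + 2 * r1"
        using 5 False by (auto elim!: oddE)
      ultimately show ?thesis using S False b 5 xb[of "b + (d - 1)"] xb[of i] by simp
    qed
  qed
qed

subsection \<open>Bounds for the spectral radius\<close>

text \<open>Collatz-Wielandt bound: take an eigenvector \<open>v\<close> for an eigenvalue of
  largest modulus and read its equation at an index where the ratio of \<open>norm (v $ i)\<close>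
  to \<open>x i\<close> is maximal.\<close>

lemma spectral_radius_le:
  assumes A: "A \<in> carrier_mat n n" and n: "0 < n"
    and x: "\<And>i. i < n \<Longrightarrow> 0 < (x i :: real)"
    and le: "\<And>i. i < n \<Longrightarrow> (\<Sum>j<n. norm (A $$ (i, j)) * x j) \<le> l * x i"
  shows "spectral_radius A \<le> l"
proof -
  obtain k where k: "k \<in> spectrum A" and sr: "spectral_radius A = norm k"
    using spectral_radius_mem_max(1)[OF A n] by auto
  then obtain v where "eigenvector A v k" by (auto simp: spectrum_def eigenvalue_def)
  with A have v: "v \<in> carrier_vec n" "v \<noteq> 0\<^sub>v n" "A *\<^sub>v v = k \<cdot>\<^sub>v v"
    by (auto simp: eigenvector_def)
  define w where "w i = norm (v $ i) / x i" for i
  have nv: "norm (v $ i) = w i * x i" if "i < n" for i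
    using x[OF that] by (simp add: w_def)
  obtain m where m: "m < n" and max: "\<And>i. i < n \<Longrightarrow> w i \<le> w m"
  proof -
    have "Max (w ` {..<n}) \<in> w ` {..<n}" using n by (intro Max_in) auto
    then obtain m where "m < n" "w m = Max (w ` {..<n})" by auto
    then show ?thesis using that[of m] by simp
  qed
  have wm: "0 < w m"
  proof (rule ccontr)
    assume "\<not> 0 < w m"
    then have "norm (v $ i) \<le> 0" if "i < n" for i
      using max[OF that] nv[OF that] x[OF that] by (simp add: mult_nonpos_nonneg)
    then have "v = 0\<^sub>v n" using v(1) by (intro eq_vecI) auto
    with v(2) show False by simp
  qed
  have "norm k * (w m * x m) = norm ((A *\<^sub>v v) $ m)"
    using v m nv by (simp add: norm_mult)
  also have "(A *\<^sub>v v) $ m = (\<Sum>j<n. A $$ (m, j) * v $ j)"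
    using A v(1) m by (simp add: scalar_prod_def atLeast0LessThan)
  also have "norm \<dots> \<le> (\<Sum>j<n. norm (A $$ (m, j)) * (w j * x j))"
    by (rule order_trans[OF norm_sum]) (simp add: norm_mult nv)
  also have "\<dots> \<le> (\<Sum>j<n. norm (A $$ (m, j)) * (w m * x j))"
    using max x by (intro sum_mono mult_left_mono mult_right_mono) (auto intro: less_imp_le)
  also have "\<dots> = w m * (\<Sum>j<n. norm (A $$ (m, j)) * x j)"
    by (simp add: sum_distrib_left algebra_simps)
  also have "\<dots> \<le> w m * (l * x m)" using le[OF m] wm by simp
  finally have "norm k * (w m * x m) \<le> l * (w m * x m)" by (simp add: algebra_simps)
  with wm x[OF m] show ?thesis unfolding sr by simp
qed

lemma spectral_radius_ge:
  assumes A: "A \<in> carrier_mat n n"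
    and x: "i < n" "x i \<noteq> 0"
    and eq: "\<And>i. i < n \<Longrightarrow> (\<Sum>j<n. A $$ (i, j) * x j) = l * x i"
  shows "norm l \<le> spectral_radius A"
proof -
  have "vec n x \<noteq> 0\<^sub>v n" using x by (metis index_vec index_zero_vec(1))
  moreover have "A *\<^sub>v vec n x = l \<cdot>\<^sub>v vec n x"
    using A eq by (intro eq_vecI) (auto simp: scalar_prod_def atLeast0LessThan)
  ultimately have "l \<in> spectrum A"
    using A by (auto simp: spectrum_def eigenvalue_def eigenvector_def intro!: exI[of _ "vec n x"])
  then show ?thesis using spectral_radius_mem_max(2)[OF A] x(1) by auto
qed

subsection \<open>The secular equation\<close>

text \<open>
  The value at distance \<open>i\<close> from \<open>u\<close>, normalised to 1 at \<open>u\<close>. The pendant path is the case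
  \<open>c = -1\<close>, \<open>q = h + 1\<close>, in which the value vanishes one step beyond its end.
\<close>

definition arm :: "real \<Rightarrow> real \<Rightarrow> nat \<Rightarrow> nat \<Rightarrow> real" where
  "arm c t q i = (c * t ^ (q - i) + 1 / t ^ (q - i)) / (c * t ^ q + 1 / t ^ q)"

text \<open>The value of \<open>c\<close> for which the eigenvalue equation holds at a hub with \<open>k + 1\<close> legs.\<close>

definition hub_coeff :: "real \<Rightarrow> real \<Rightarrow> real" where
  "hub_coeff k T = T * (T^2 - k * (T + 1)) / (k * T * (T + 1) - 1)"

text \<open>The defect of the eigenvalue equation at \<open>u\<close>, divided by \<open>t - 1 / t\<close>.\<close>

definition secular :: "real \<Rightarrow> real \<Rightarrow> nat \<Rightarrow> nat \<Rightarrow> nat \<Rightarrow> real \<Rightarrow> real" where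
  "secular k1 k2 h q1 q2 T =
     1 - 1 / (T - 1) + 1 / (T ^ (h + 1) - 1)
     - 1 / (1 + hub_coeff k1 T * T ^ q1) - 1 / (1 + hub_coeff k2 T * T ^ q2)"

section \<open>Solving the eigenvalue equation along one arm\<close>

lemma hub_denominator:
  assumes "1 \<le> k" "1 < (T::real)"
  shows "1 < k * T * (T + 1)"
proof -
  have "1 < 1 * T * 1" using assms by simp
  also have "\<dots> < k * T * (T + 1)" using assms by (intro mult_le_less_imp_less) auto
  finally show ?thesis .
qed

lemma arm_0: "c * t ^ q + 1 / t ^ q \<noteq> 0 \<Longrightarrow> arm c t q 0 = 1"
  by (simp add: arm_def)

text \<open>Both \<open>t ^ m\<close> and \<open>1 / t ^ m\<close> solve the recurrence with factor
  \<open>t + 1 / t\<close>, hence so does every linear combination.\<close>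

lemma arm_step:
  assumes "t \<noteq> 0" "1 \<le> i" "i < q"
  shows "(t + 1 / t) * arm c t q i = arm c t q (i - 1) + arm c t q (i + 1)"
proof -
  obtain d where d: "q = i + 1 + d" using assms(3) less_iff_Suc_add by auto
  have "q - i = d + 1" "q - (i - 1) = d + 2" "q - (i + 1) = d" using d assms by auto
  then show ?thesis unfolding arm_def times_divide_eq_right add_divide_distrib[symmetric]
    using assms by (intro arg_cong2[where f = "(/)"]) (auto simp: field_simps power2_eq_square)
qed

text \<open>Splitting off \<open>1 / t\<close>, which is the same for all arms, leaves
  \<open>c\<close> and \<open>q\<close> only in a fraction of the form that occurs in
  \<open>secular\<close>, with \<open>T = t^2\<close>.\<close>

lemma arm_1:
  assumes t: "t > 1" "1 \<le> q" and nz: "c * t ^ q + 1 / t ^ q \<noteq> 0"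
  shows "arm c t q 1 = 1 / t + (t - 1 / t) / (1 + c * (t^2) ^ q)"
proof -
  obtain d where d: "q = Suc d" using t(2) by (cases q) auto
  have D: "c * t ^ q + 1 / t ^ q = (1 + c * (t^2) ^ q) / t ^ q"
    using t by (simp add: field_simps power2_eq_square power_mult_distrib)
  with nz have nz': "1 + c * (t^2) ^ q \<noteq> 0" by auto
  have "(c * t ^ d + 1 / t ^ d) * t ^ q = 1 / t * (1 + c * (t^2) ^ q) + (t - 1 / t)"
    using t unfolding d by (simp add: field_simps power2_eq_square power_mult_distrib)
  then have "arm c t q 1 =
      (1 / t * (1 + c * (t^2) ^ q) + (t - 1 / t)) / (1 + c * (t^2) ^ q)"
    unfolding arm_def D by (simp add: d)
  also have "\<dots> = 1 / t + (t - 1 / t) / (1 + c * (t^2) ^ q)"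
    using nz' by (subst add_divide_distrib) simp
  finally show ?thesis .
qed

text \<open>The normalising denominator of \<open>arm\<close> cancels. What remains is a linear
  equation for \<open>c\<close> that does not involve \<open>q\<close>, and \<open>hub_coeff\<close>
  is its solution.\<close>

lemma arm_hub:
  assumes t: "t > 1" and q: "1 \<le> q" and k: "1 \<le> k"
  defines "c \<equiv> hub_coeff k (t^2)" and "l \<equiv> t + 1 / t"
  shows "l * arm c t q q = arm c t q (q - 1) + (k + 1) * (arm c t q q * (l / (l^2 - 1)))"
proof -
  have e: "q - (q - 1) = 1" using q by simp
  have key: "l * (c + 1) = (c * t + 1 / t) + (k + 1) * ((c + 1) * (l / (l^2 - 1)))"
  proof -
    have t2: "t^2 > 1" using t by (simp add: one_less_power)
    define T where "T = t^2"
    have T: "T > 1" using t2 T_def by simp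
    have nz: "k * T * (T + 1) - 1 > 0" using hub_denominator[OF k T] by simp
    have l1: "l / (l^2 - 1) = t * (T + 1) / (T^2 + T + 1)"
    proof -
      have "l^2 - 1 = (T^2 + T + 1) / T" unfolding l_def T_def using t
        by (simp add: field_simps power2_eq_square)
      moreover have "l = t * (T + 1) / T" unfolding l_def T_def using t
        by (simp add: field_simps power2_eq_square)
      ultimately show ?thesis using T by simp
    qed
    have c1: "c + 1 = (T^3 - 1) / (k * T * (T + 1) - 1)"
      unfolding c_def hub_coeff_def T_def[symmetric] using nz
      by (simp add: field_simps power2_eq_square power3_eq_cube)
    have cube: "T^3 - 1 = (T - 1) * (T^2 + T + 1)"
      by (simp add: algebra_simps power2_eq_square power3_eq_cube)
    have "T^2 + T + 1 > 0" using T by (simp add: add_pos_pos)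
    \<comment> \<open>The factor \<open>T^2 + T + 1\<close> occurs in \<open>c + 1\<close> and in
      the denominator of \<open>l / (l^2 - 1)\<close>, and cancels.\<close>
    then have c2: "(c + 1) * (l / (l^2 - 1)) = (T - 1) * t * (T + 1) / (k * T * (T + 1) - 1)"
      unfolding c1 cube l1 by simp
    have tT: "t * t = T" by (simp add: T_def power2_eq_square)
    have "l * (c + 1) - (c * t + 1 / t) = c / t + t" unfolding l_def
      by (simp add: algebra_simps add_divide_distrib)
    also have "\<dots> = (c + T) / t" using t tT by (simp add: field_simps)
    also have "c + T = T * (T^2 - k * (T + 1) + k * T * (T + 1) - 1) / (k * T * (T + 1) - 1)"
      unfolding c_def hub_coeff_def T_def[symmetric] using nz by (simp add: field_simps)
    also have "T^2 - k * (T + 1) + k * T * (T + 1) - 1 = (k + 1) * ((T - 1) * (T + 1))"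
      by (simp add: algebra_simps power2_eq_square)
    also have "T * ((k + 1) * ((T - 1) * (T + 1))) / (k * T * (T + 1) - 1) / t
       = (k + 1) * ((T - 1) * t * (T + 1) / (k * T * (T + 1) - 1))"
      using t by (simp add: tT[symmetric])
    finally show ?thesis unfolding c2 by simp
  qed
  have "arm c t q q = (c + 1) / (c * t ^ q + 1 / t ^ q)"
       "arm c t q (q - 1) = (c * t + 1 / t) / (c * t ^ q + 1 / t ^ q)"
    unfolding arm_def e by simp_all
  moreover have "l * (A / D) = B / D + K * (A / D * M)" if "l * A = B + K * (A * M)" for A B K M D
    using arg_cong[OF that, of "\<lambda>y. y / D"] by (simp add: add_divide_distrib)
  ultimately show ?thesis using key by (simp only:)
qed

section \<open>Signs and continuity of the secular function\<close>

lemma hub_coeff_pos: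
  assumes "1 \<le> k" "T > 1" "k * (T + 1) < T^2"
  shows "0 < hub_coeff k T"
proof -
  show ?thesis unfolding hub_coeff_def using hub_denominator[OF assms(1,2)] assms
    by (intro divide_pos_pos mult_pos_pos) auto
qed

text \<open>For such \<open>T\<close> both hub coefficients are at least 1 and \<open>T\<close> is
  at least 7, so the negative terms add up to at most 1/6 + 1/8 + 1/8.\<close>

lemma secular_pos:
  assumes k: "1 \<le> k1" "k1 \<le> k2" and q: "1 \<le> q1" "1 \<le> q2" and T: "2 * k2 + 5 \<le> T"
  shows "0 < secular k1 k2 h q1 q2 T"
proof -
  have c: "1 \<le> hub_coeff k T" if "1 \<le> k" "2 * k + 5 \<le> T" for k
  proof -
    have T1: "T > 1" using that by simp
    have d: "1 < k * T * (T + 1)" by (rule hub_denominator[OF that(1) T1])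
    \<comment> \<open>A coefficient of at least 1 amounts to
      \<open>2 * k * T * (T + 1) \<le> T^3 + 1\<close>.\<close>
    have "2 * k * (T * (T + 1)) \<le> (T - 5) * (T * (T + 1))"
      using that T1 by (intro mult_right_mono) auto
    also have "\<dots> = T^3 - 4 * T^2 - 5 * T"
      by (simp add: algebra_simps power2_eq_square power3_eq_cube)
    also have "\<dots> \<le> T^3" using T1 by (smt (verit) zero_le_power2)
    finally have "k * T * (T + 1) - 1 \<le> T * (T^2 - k * (T + 1))"
      by (simp add: algebra_simps power2_eq_square power3_eq_cube)
    then show ?thesis unfolding hub_coeff_def using d T1 by simp
  qed
  have T7: "T \<ge> 7" using k T by linarith
  have y: "1 / (1 + hub_coeff k T * T ^ q) \<le> 1 / 8" if "1 \<le> k" "k \<le> k2" "1 \<le> q" for k q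
  proof -
    have "7 \<le> T ^ 1" using T7 by simp
    also have "\<dots> \<le> T ^ q" using T7 that by (intro power_increasing) auto
    finally have "1 * 7 \<le> hub_coeff k T * T ^ q"
      using c[of k] that T by (intro mult_mono) auto
    then have "8 \<le> 1 + hub_coeff k T * T ^ q" by simp
    then show ?thesis by (intro divide_left_mono) auto
  qed
  have "1 / (T - 1) \<le> 1 / 6" using T7 by (intro divide_left_mono) auto
  moreover have "1 / (T ^ (h + 1) - 1) \<ge> 0"
    using T7 one_le_power[of T "h + 1"] by simp
  ultimately show ?thesis unfolding secular_def
    using y[of k1 q1] y[of k2 q2] k q by linarith
qed

text \<open>Here the coefficient of the heavier hub vanishes, so its fraction equals 1 and cancels
  the leading 1. The pendant path contributes nothing positive, and the lighter hub a negative
  term.\<close>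

lemma secular_neg:
  assumes k: "1 \<le> k1" "k1 < k2" and T: "T > 1" "T^2 = k2 * (T + 1)" and h: "1 \<le> h"
  shows "secular k1 k2 h q1 q2 T < 0"
proof -
  have "k1 * (T + 1) < T^2" using k T by simp
  then have c1: "0 < hub_coeff k1 T" using k T by (intro hub_coeff_pos) auto
  then have "0 < 1 / (1 + hub_coeff k1 T * T ^ q1)"
    using T by (intro divide_pos_pos add_pos_pos mult_pos_pos) auto
  moreover have "1 / (1 + hub_coeff k2 T * T ^ q2) = 1" unfolding hub_coeff_def T(2) by simp
  moreover have "T \<le> T ^ (h + 1)" using T power_increasing[of 1 "h + 1" T] by simp
  then have "1 / (T ^ (h + 1) - 1) \<le> 1 / (T - 1)"
    using T by (intro divide_left_mono mult_pos_pos) linarith+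
  ultimately show ?thesis unfolding secular_def by linarith
qed

text \<open>On the interval both hub coefficients are nonnegative, which keeps the denominators
  \<open>1 + hub_coeff k T * T ^ q\<close> away from 0. The bound is not strict, so the zero of the
  heavier coefficient may be the left end.\<close>

lemma continuous_on_secular:
  assumes k: "1 \<le> k1" "k1 \<le> k2" and T1: "T1 > 1" and "\<And>T. T \<in> {T1..T2} \<Longrightarrow> k2 * (T + 1) \<le> T^2"
  shows "continuous_on {T1..T2} (secular k1 k2 h q1 q2)"
proof -
  have d: "1 < k * T * (T + 1)" if "1 \<le> k" "T \<in> {T1..T2}" for k T :: real
    using that T1 by (intro hub_denominator) auto
  have y: "1 + hub_coeff k T * T ^ q \<noteq> 0" if k': "1 \<le> k" "k \<le> k2" "T \<in> {T1..T2}" for k T q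
  proof -
    have T: "1 < T" using k' T1 by simp
    have "k * (T + 1) \<le> k2 * (T + 1)" using k' T by (intro mult_right_mono) auto
    then have "k * (T + 1) \<le> T^2" using assms(4)[OF k'(3)] by linarith
    then have "0 \<le> hub_coeff k T" unfolding hub_coeff_def using d[OF k'(1,3)] T
      by (intro divide_nonneg_pos mult_nonneg_nonneg) auto
    then have "0 \<le> hub_coeff k T * T ^ q" using T by simp
    then show ?thesis by linarith
  qed
  have h: "T ^ (h + 1) - 1 \<noteq> 0" if "T \<in> {T1..T2}" for T
    using that T1 one_less_power[of T "h + 1"] by auto
  have c: "continuous_on {T1..T2} (hub_coeff k)" if "1 \<le> k" for k
    unfolding hub_coeff_def using d[OF that] by (intro continuous_intros) force
  show ?thesis unfolding secular_def[abs_def]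
    using y k h T1 by (intro continuous_intros c) auto
qed

text \<open>Here \<open>q1\<close> is the shortened length, so the trees are
  \<open>[h, q1, q2 + 1]\<close> and \<open>[h, q1 + 1, q2]\<close>. The change of the secular
  function is \<open>f X1 - f X2\<close> with
  \<open>f Y = 1 / (1 + Y) - 1 / (1 + T * Y)\<close>.\<close>

lemma secular_decreasing_at_root:
  assumes k: "1 \<le> k1" "k1 + 1 \<le> k2" and q: "2 \<le> q1" and h: "1 \<le> h" and T: "T > 1" "k2 * (T + 1) < T^2"
    and root: "secular k1 k2 h q1 (q2 + 1) T = 0"
  shows "secular k1 k2 h (q1 + 1) q2 T < 0"
proof -
  have k1T: "k1 * (T + 1) < T^2 - (T + 1)"
  proof -
    have "(k1 + 1) * (T + 1) \<le> k2 * (T + 1)" using k T by (intro mult_right_mono) auto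
    then show ?thesis using T by (simp add: algebra_simps)
  qed
  define X1 where "X1 = hub_coeff k1 T * T ^ q1"
  define X2 where "X2 = hub_coeff k2 T * T ^ q2"
  have c1: "0 < hub_coeff k1 T" using k T k1T by (intro hub_coeff_pos) auto
  have c2: "0 < hub_coeff k2 T" using k T by (intro hub_coeff_pos) auto
  have X: "0 < X1" "0 < X2" using c1 c2 T by (auto simp: X1_def X2_def)
  define g where "g = 1 / (T - 1) - 1 / (T ^ (h + 1) - 1)"
  have sec: "secular k1 k2 h q1 (q2 + 1) T = 1 - g - 1 / (1 + X1) - 1 / (1 + T * X2)"
    "secular k1 k2 h (q1 + 1) q2 T = 1 - g - 1 / (1 + T * X1) - 1 / (1 + X2)"
    by (simp_all add: secular_def g_def X1_def X2_def mult_ac)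
  have "T < T ^ (h + 1)" using T h power_strict_increasing[of 1 "h+1" T] by simp
  then have "T - 1 < T ^ (h + 1) - 1" "0 < T ^ (h + 1) - 1" using T by linarith+
  then have g: "0 < g" "g < 1 / (T - 1)"
    unfolding g_def using T frac_less2[of 1 1 "T - 1" "T ^ (h + 1) - 1"] by auto
  have TX: "0 < T * X1" "0 < T * X2" using X T by auto
  \<comment> \<open>Since \<open>k2 \<ge> 2\<close>, \<open>T\<close> exceeds the positive root
    \<open>1 + sqrt 3\<close> of \<open>T^2 = 2 * (T + 1)\<close>.\<close>
  have T27: "T > 2.7"
  proof (rule ccontr)
    assume "\<not> T > 2.7"
    then have "(T - 1) * (T - 1) \<le> 1.7 * 1.7" using T by (intro mult_mono) auto
    moreover have "2 * (T + 1) \<le> k2 * (T + 1)" using k T by (intro mult_right_mono) auto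
    ultimately show False using T by (simp add: algebra_simps power2_eq_square)
  qed
  have X1T: "T + 1 < X1"
  proof -
    define m where "m = k1 * (T + 1)"
    have d: "1 < k1 * T * (T + 1)" using k T by (intro hub_denominator) auto
    have "(T + 1) * (k1 * T * (T + 1) - 1) < T * (T + 1) * m"
      using T by (simp add: m_def algebra_simps)
    also have "\<dots> \<le> T * (T + 1) * T^2" using k1T T by (simp add: m_def)
    \<comment> \<open>The gap of at least 1 between \<open>k1\<close> and \<open>k2\<close> enters
      here, as \<open>T + 1 < T^2 - m\<close>.\<close>
    also have "\<dots> < T * (T^2 - m) * T^2" using k1T T by (simp add: m_def)
    finally have "(T + 1) * (k1 * T * (T + 1) - 1) < T * (T^2 - k1 * (T + 1)) * T^2"
      by (simp add: m_def)
    then have "T + 1 < hub_coeff k1 T * T^2" using d T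
      by (simp add: hub_coeff_def field_simps)
    also have "\<dots> \<le> X1" unfolding X1_def using c1 T q
      by (intro mult_left_mono power_increasing) auto
    finally show ?thesis .
  qed
  \<comment> \<open>Otherwise both hub fractions are small: with \<open>g < 3/5\<close> the total is
    at most 1/4 + 1/10 + 3/5 < 1, whereas a root requires exactly 1.\<close>
  have main: "X2 < X1"
  proof (rule ccontr)
    assume "\<not> X2 < X1"
    then have X21: "X1 \<le> X2" by simp
    have "1 / (1 + X1) \<le> 1 / 4" using X1T T27 by (simp add: divide_le_eq)
    moreover have "2.7 * 3.7 \<le> T * X2" using X1T X21 T27 by (intro mult_mono) auto
    then have "1 / (1 + T * X2) \<le> 1 / 10" by (simp add: divide_le_eq)
    moreover have "1 / (T - 1) \<le> 3 / 5" using T27 by (simp add: divide_le_eq)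
    ultimately show False using root g(2) sec(1) by linarith
  qed
  \<comment> \<open>As \<open>g > 0\<close>, the hub fractions sum to less than 1; clearing
    denominators turns this into \<open>1 < T * X1 * X2\<close>.\<close>
  have "1 / (1 + X1) + 1 / (1 + T * X2) < 1" using root g sec by simp
  moreover have "1 / (1 + X1) + 1 / (1 + T * X2) = (2 + X1 + T * X2) / ((1 + X1) * (1 + T * X2))"
    using X TX by (simp add: add_frac_eq)
  moreover have "0 < (1 + X1) * (1 + T * X2)" using X TX by simp
  ultimately have "2 + X1 + T * X2 < (1 + X1) * (1 + T * X2)" by simp
  then have P: "1 < X1 * (T * X2)" by (simp add: algebra_simps)
  have "1 / (1 + X1) + 1 / (1 + T * X2) < 1 / (1 + T * X1) + 1 / (1 + X2)"
  proof -
    have "0 < (T - 1) * (X1 - X2) * (X1 * (T * X2) - 1)" using main P T by simp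
    also have "\<dots> = (T - 1) * (X2 * ((1 + X1) * (1 + T * X1)) - X1 * ((1 + X2) * (1 + T * X2)))"
      by (simp add: algebra_simps)
    finally have "X1 * ((1 + X2) * (1 + T * X2)) < X2 * ((1 + X1) * (1 + T * X1))"
      using T by (simp add: zero_less_mult_iff)
    then have "X1 / ((1 + X1) * (1 + T * X1)) < X2 / ((1 + X2) * (1 + T * X2))"
      using X TX by (simp add: frac_less_eq divide_less_0_iff pos_divide_less_eq pos_less_divide_eq add_pos_pos)
    then have "(T - 1) * (X1 / ((1 + X1) * (1 + T * X1))) < (T - 1) * (X2 / ((1 + X2) * (1 + T * X2)))"
      using T by (intro mult_strict_left_mono) auto
    moreover have "1 / (1 + Y) - 1 / (1 + T * Y) = (T - 1) * (Y / ((1 + Y) * (1 + T * Y)))"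
      if "0 < Y" for Y
    proof -
      have "0 < T * Y" using that T by simp
      then have "1 + Y \<noteq> 0" "1 + T * Y \<noteq> 0" using that by linarith+
      then show ?thesis by (simp add: diff_frac_eq algebra_simps)
    qed
    ultimately show ?thesis using X by (smt (verit))
  qed
  then show ?thesis using root sec by simp
qed

section \<open>From a root of the secular equation to the spectral radius\<close>

lemma arm_pos:
  assumes "0 < c" "0 < t"
  shows "0 < arm c t q i"
  unfolding arm_def using assms by (intro divide_pos_pos add_pos_pos mult_pos_pos) auto

text \<open>Numerator and denominator are both negative. With \<open>q = h + 1\<close> this covers
  the whole pendant path.\<close>

lemma arm_minus_one_pos:
  assumes "1 < t" "i < q"
  shows "0 < arm (-1) t q i"
proof -
  have "1 / t ^ m < t ^ m" if "0 < m" for m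
  proof -
    have "1 < t ^ m" using assms(1) that by (rule one_less_power)
    moreover from this have "1 / t ^ m < 1" by simp
    ultimately show ?thesis by linarith
  qed
  from this[of "q - i"] this[of q] assms show ?thesis
    unfolding arm_def by (intro divide_neg_neg) auto
qed

text \<open>The three arms are glued into a positive eigenvector, which bounds the spectral radius
  from above by comparison and from below as an eigenvector.\<close>

lemma tree_rho_eq:
  assumes pos: "1 \<le> h" "1 \<le> q1" "1 \<le> q2" and r: "2 \<le> r1" "2 \<le> r2" and T: "1 < T"
    and c: "0 < hub_coeff (real r1 - 1) T" "0 < hub_coeff (real r2 - 1) T"
    and root: "secular (real r1 - 1) (real r2 - 1) h q1 q2 T = 0"
  shows "tree_rho r1 r2 h q1 q2 = sqrt T + 1 / sqrt T"
proof -
  define t where "t = sqrt T"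
  have t: "1 < t" "t^2 = T" using T by (simp_all add: t_def)
  define l where "l = t + 1 / t"
  define c1 where "c1 = hub_coeff (real r1 - 1) T"
  define c2 where "c2 = hub_coeff (real r2 - 1) T"
  have c': "0 < c1" "0 < c2" using c by (simp_all add: c1_def c2_def)
  let ?P = "arm (-1) t (h + 1)" and ?Q1 = "arm c1 t q1" and ?Q2 = "arm c2 t q2"
  let ?x = "tree_vec r1 h q1 q2 l ?P ?Q1 ?Q2"
  let ?n = "tree_order r1 r2 h q1 q2" and ?A = "tree_adj r1 r2 h q1 q2"
  have l: "1 < l" using t unfolding l_def by (simp add: add_pos_pos less_add_same_cancel1 less_trans)
  then have l1: "0 < l^2 - 1" by simp
  have "1 < t ^ (h + 1)" using t(1) by (intro one_less_power) auto
  then have "1 / t ^ (h + 1) < t ^ (h + 1)" using less_trans[of "1 / t ^ (h + 1)" 1] by simp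
  then have nz0: "-1 * t ^ (h + 1) + 1 / t ^ (h + 1) \<noteq> 0" by simp
  have nz: "c * t ^ q + 1 / t ^ q \<noteq> 0" if "0 < c" for c q
    using that t by (intro less_imp_neq[symmetric] add_pos_pos mult_pos_pos) auto
  have eigen: "(\<Sum>j<?n. (if (i, j) \<in> tree_edges r1 r2 h q1 q2 \<or> (j, i) \<in> tree_edges r1 r2 h q1 q2
             then 1 else 0) * ?x j) = l * ?x i" if i: "i < ?n" for i
    unfolding tree_row_sum[OF pos i]
  proof (rule tree_vec_eigen[OF pos i])
    show "l^2 \<noteq> 1" using l1 by simp
    show "?P 0 = 1" by (rule arm_0[OF nz0])
    show "?Q1 0 = 1" "?Q2 0 = 1" using arm_0 nz c' by auto
    have 1: "?P 1 = 1 / t - (t - 1 / t) * (1 / (T ^ (h + 1) - 1))"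
    proof -
      have "1 + -1 * T ^ (h + 1) = - (T ^ (h + 1) - 1)" by simp
      then show ?thesis using arm_1[OF t(1) _ nz0] unfolding t(2)
        by (simp only: divide_minus_right) simp
    qed
    have 2: "?Q1 1 = 1 / t + (t - 1 / t) * (1 / (1 + c1 * T ^ q1))"
      "?Q2 1 = 1 / t + (t - 1 / t) * (1 / (1 + c2 * T ^ q2))"
      using arm_1[OF t(1) pos(2) nz[OF c'(1)]] arm_1[OF t(1) pos(3) nz[OF c'(2)]] t(2) by auto
    have "1 / (1 + c1 * T ^ q1) + 1 / (1 + c2 * T ^ q2) - 1 / (T ^ (h + 1) - 1) = 1 - 1 / (T - 1)"
      using root unfolding secular_def c1_def c2_def by simp
    moreover have "?P 1 + ?Q1 1 + ?Q2 1 = 3 / t + (t - 1 / t) *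
        (1 / (1 + c1 * T ^ q1) + 1 / (1 + c2 * T ^ q2) - 1 / (T ^ (h + 1) - 1))"
      unfolding 1 2 by (simp only: distrib_left right_diff_distrib)
    ultimately have "?P 1 + ?Q1 1 + ?Q2 1 = 3 / t + (t - 1 / t) * (1 - 1 / (T - 1))" by simp
    \<comment> \<open>Because \<open>(t - 1 / t) / (T - 1) = 1 / t\<close>.\<close>
    also have "\<dots> = l" unfolding l_def t(2)[symmetric] using t T
      by (simp add: field_simps power2_eq_square)
    finally show "l = ?P 1 + ?Q1 1 + ?Q2 1" ..
    show "l * ?P i = ?P (i - 1) + ?P (i + 1)" if "1 \<le> i" "i < h" for i
      unfolding l_def using that t by (intro arm_step) auto
    \<comment> \<open>The general recurrence applies at the leaf, because the arm vanishes at the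
      fictitious index \<open>h + 1\<close>.\<close>
    show "l * ?P h = ?P (h - 1)"
      using arm_step[of t h "h + 1" "-1"] t pos by (simp add: l_def arm_def)
    show "l * ?Q1 i = ?Q1 (i - 1) + ?Q1 (i + 1)" if "1 \<le> i" "i < q1" for i
      unfolding l_def using that t by (intro arm_step) auto
    show "l * ?Q2 i = ?Q2 (i - 1) + ?Q2 (i + 1)" if "1 \<le> i" "i < q2" for i
      unfolding l_def using that t by (intro arm_step) auto
    show "l * ?Q1 q1 = ?Q1 (q1 - 1) + r1 * (?Q1 q1 * (l / (l^2 - 1)))"
      using arm_hub[OF t(1) pos(2), of "real r1 - 1"] r t(2) unfolding l_def c1_def
      by simp
    show "l * ?Q2 q2 = ?Q2 (q2 - 1) + r2 * (?Q2 q2 * (l / (l^2 - 1)))"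
      using arm_hub[OF t(1) pos(3), of "real r2 - 1"] r t(2) unfolding l_def c2_def
      by simp
  qed
  have xpos: "0 < ?x i" for i
  proof -
    have "0 < ?Q1 j" "0 < ?Q2 j" for j using c' t by (auto intro: arm_pos)
    moreover have "0 < ?P j" if "j \<le> h" for j using that t by (intro arm_minus_one_pos) auto
    ultimately show ?thesis using l l1 unfolding tree_vec_def by simp
  qed
  have A: "?A \<in> carrier_mat ?n ?n" by (simp add: tree_adj_def)
  have n: "0 < ?n" by (simp add: tree_order_def)
  have "spectral_radius ?A \<le> l"
  proof (rule spectral_radius_le[OF A n])
    fix i assume i: "i < ?n"
    have "(\<Sum>j<?n. norm (?A $$ (i, j)) * ?x j) = l * ?x i"
      unfolding eigen[OF i, symmetric] using i by (intro sum.cong) (auto simp: tree_adj_def)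
    then show "(\<Sum>j<?n. norm (?A $$ (i, j)) * ?x j) \<le> l * ?x i" by simp
  qed (rule xpos)
  moreover have "norm (complex_of_real l) \<le> spectral_radius ?A"
  proof (rule spectral_radius_ge[OF A n, of "\<lambda>i. complex_of_real (?x i)"])
    show "complex_of_real (?x 0) \<noteq> 0" using xpos[of 0] by simp
    fix i assume i: "i < ?n"
    have "(\<Sum>j<?n. ?A $$ (i, j) * complex_of_real (?x j)) = complex_of_real (l * ?x i)"
      unfolding eigen[OF i, symmetric] of_real_sum
      using i by (intro sum.cong) (auto simp: tree_adj_def)
    then show "(\<Sum>j<?n. ?A $$ (i, j) * complex_of_real (?x j)) =
        complex_of_real l * complex_of_real (?x i)" by simp
  qed
  moreover have "norm (complex_of_real l) = l" unfolding norm_of_real using l by simp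
  ultimately have "spectral_radius ?A = l" by simp
  then show ?thesis by (simp only: tree_rho_def l_def t_def)
qed

section \<open>Existence of roots and comparison of the two trees\<close>

lemma secular_root:
  assumes k: "1 \<le> k1" "k1 \<le> k2" and q: "1 \<le> q1" "1 \<le> q2"
    and a: "1 < a" "k2 * (a + 1) \<le> a^2" and neg: "secular k1 k2 h q1 q2 a < 0"
  obtains T where "a < T" "k2 * (T + 1) < T^2" "secular k1 k2 h q1 q2 T = 0"
proof -
  \<comment> \<open>The quotient \<open>T^2 / (T + 1)\<close> increases with \<open>T\<close>, so
    the condition at \<open>a\<close> persists, strictly, to its right.\<close>
  have mono: "k2 * (T + 1) < T^2" if "a < T" for T
  proof -
    have "a * a < T * T" using that a by (intro mult_strict_mono) auto
    moreover have "a * T * a < a * T * T" using that a by simp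
    ultimately have "a^2 * (T + 1) < T^2 * (a + 1)" by (simp add: algebra_simps power2_eq_square)
    moreover have "k2 * (a + 1) * (T + 1) \<le> a^2 * (T + 1)"
      using a that by (intro mult_right_mono) auto
    ultimately have "k2 * (T + 1) * (a + 1) < T^2 * (a + 1)" by (simp add: mult_ac)
    then show ?thesis using a by simp
  qed
  define b where "b = max a (2 * k2 + 5)"
  have "0 < secular k1 k2 h q1 q2 b" using k q by (intro secular_pos) (auto simp: b_def)
  moreover have "continuous_on {a..b} (secular k1 k2 h q1 q2)"
    using a mono by (intro continuous_on_secular k) (force simp: less_le)+
  moreover have "a \<le> b" by (simp add: b_def)
  ultimately have "\<exists>T\<ge>a. T \<le> b \<and> secular k1 k2 h q1 q2 T = 0"
    using neg by (intro IVT') auto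
  then obtain T where T: "a \<le> T" "secular k1 k2 h q1 q2 T = 0" by blast
  with neg have "a < T" by (cases "a = T") auto
  with T(2) mono that show ?thesis by blast
qed

theorem theorem4p2:
  fixes r1 r2 h q1 q2 :: nat
  assumes "2 \<le> r1" and "r1 < r2"
    and "2 \<le> h" and "3 \<le> q1" and "2 \<le> q2"
  shows "tree_rho r1 r2 h q1 q2 > tree_rho r1 r2 h (q1 - 1) (q2 + 1)"
proof -
  define k1 where "k1 = real r1 - 1"
  define k2 where "k2 = real r2 - 1"
  have k: "1 \<le> k1" "k1 + 1 \<le> k2" using assms by (auto simp: k1_def k2_def)
  \<comment> \<open>The positive root of \<open>x^2 = k2 * (x + 1)\<close>, where the coefficient of
    the heavier hub vanishes.\<close>
  define a where "a = (k2 + sqrt (k2^2 + 4 * k2)) / 2"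
  have "k2 < sqrt (k2^2 + 4 * k2)" using k by (intro real_less_rsqrt) simp
  then have a1: "1 < a" using k by (simp add: a_def)
  have "2 * a - k2 = sqrt (k2^2 + 4 * k2)" unfolding a_def by (simp add: field_simps)
  then have "(2 * a - k2)^2 = k2^2 + 4 * k2" using k by simp
  then have a2: "a^2 = k2 * (a + 1)" by (simp add: algebra_simps power2_eq_square)
  have "secular k1 k2 h (q1 - 1) (q2 + 1) a < 0"
    using k a1 a2 assms by (intro secular_neg) auto
  then obtain T0 where T0: "a < T0" "k2 * (T0 + 1) < T0^2" "secular k1 k2 h (q1 - 1) (q2 + 1) T0 = 0"
    using k a1 a2 assms by (elim secular_root[rotated -1]) auto
  have "secular k1 k2 h (q1 - 1 + 1) q2 T0 < 0"
    using k a1 T0 assms by (intro secular_decreasing_at_root) auto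
  then have "secular k1 k2 h q1 q2 T0 < 0" using assms by simp
  \<comment> \<open>The root \<open>T0\<close> of the modified tree now serves as the left end of
    the search, which forces \<open>T0 < T\<close>.\<close>
  then obtain T where T: "T0 < T" "k2 * (T + 1) < T^2" "secular k1 k2 h q1 q2 T = 0"
    using k a1 T0 assms by (elim secular_root[rotated -1]) auto
  have c: "0 < hub_coeff k1 X" "0 < hub_coeff k2 X" if "a < X" "k2 * (X + 1) < X^2" for X
  proof -
    have "k1 * (X + 1) \<le> k2 * (X + 1)" using k that a1 by (intro mult_right_mono) auto
    then have "k1 * (X + 1) < X^2" using that by linarith
    then show "0 < hub_coeff k1 X" "0 < hub_coeff k2 X"
      using that k a1 by (auto intro!: hub_coeff_pos)
  qed
  have "tree_rho r1 r2 h (q1 - 1) (q2 + 1) = sqrt T0 + 1 / sqrt T0"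
    using assms T0 a1 c[of T0] by (intro tree_rho_eq) (auto simp: k1_def k2_def)
  moreover have "tree_rho r1 r2 h q1 q2 = sqrt T + 1 / sqrt T"
    using assms T0 T a1 c[of T] by (intro tree_rho_eq) (auto simp: k1_def k2_def)
  \<comment> \<open>Beyond 1 the map from \<open>t\<close> to \<open>t + 1 / t\<close> is
    increasing, so the order of the roots passes to the spectral radii.\<close>
  moreover have "s + 1 / s < t + 1 / t" if "1 < s" "s < t" for s t :: real
  proof -
    have "1 < s * t" using that by (intro less_1_mult) auto
    then have "0 < (t - s) * (1 - 1 / (s * t))" using that by simp
    also have "\<dots> = (t + 1 / t) - (s + 1 / s)" using that by (simp add: field_simps)
    finally show ?thesis by simp
  qed
  from this[of "sqrt T0" "sqrt T"] have "sqrt T0 + 1 / sqrt T0 < sqrt T + 1 / sqrt T"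
    using T0 T a1 by simp
  ultimately show ?thesis by simp
qed

end
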